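(* Under the limited-risk structure ($R$) described in the context, both the optimal incentive intensity $b_{RN}^*$ and the optimal effort $e_{RN}^*$ are decreasing in the tax difference $\Delta\tau=\tau-\tau_0$ (with $\tau$ fixed).
   Context: A multinational firm has a headquarters, a retail division taxed at rate $\tau$ and a procurement division taxed at rate $\tau_0$, with $0\le\tau_0<\tau<1$. Parameters: retail price $m>0$, initial raw-material price $\gamma_0>0$, effect of effort $\eta>0$, effort cost coefficient $k>0$, markup $\alpha>0$, royalty fraction $\beta\in(0,1)$, reservation wage $a\ge 0$. Demand $D\ge 0$ is random with cumulative distribution function $F$ and density $f$; $F$ is strictly increasing on its support (an interval), with $f$ continuous and positive in its interior. Demand has an increasing generalized failure rate: $g(d)=\frac{d f(d)}{1-F(d)}$ is increasing in $d$. Expected sales at order quantity $y$ are $s(y)=\int_0^y x f(x)\,dx+\int_y^{\infty} y f(x)\,dx$. With effort $e\ge 0$ the unit purchase cost is $\gamma(e)=\gamma_0-\eta e$, the effort cost is $\frac12 k e^2$, and the transfer price is $T=(1+\alpha)\gamma(e)$. Operating parameters and effort are required to satisfy $\gamma(e)\le T\le m$ (in particular $\gamma(e)\ge 0$). Structure $R$ (principal–agent). Given $e$, the retail division chooses $y_{RN}(e)$ to maximize $\pi_{RN}^R=m\,s(y)-(1+\alpha)(\gamma_0-\eta e)y$ over $y\ge 0$; write $\pi^R_{RN}(e)$ for the maximal value. The headquarters offers a linear contract paying the procurement agent $A+b\,\pi_{RN}^R$, with fixed payment $A$ and incentive intensity $0\le b<1$. The agent, bearing the effort cost and anticipating $y_{RN}(e)$,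 chooses $e\ge 0$ to maximize $\pi_{RN}^{PC}=A+b\,\pi_{RN}^R(e)-\frac12 k e^2$ (incentive compatibility), and must receive $\pi_{RN}^{PC}\ge a$ (individual rationality). Subject to these two constraints the headquarters chooses $(A,b)$ to maximize $$\pi_{RN}^{HQ}=(1-\tau)(1-\beta)\pi_{RN}^R+(1-\tau_0)\Big[\beta\pi_{RN}^R-A-b\,\pi_{RN}^R+\alpha(\gamma_0-\eta e)y_{RN}(e)\Big].$$ The agent's optimal effort for each $b$ and the headquarters' optimal intensity $b_{RN}^*$ are unique; $b_{RN}^*\in(0,1)$, and $e_{RN}^*$ (the agent's effort at $b^*_{RN}$) is interior to the set of $e\ge 0$ satisfying $\gamma(e)\le T\le m$. *)

theory Defs
  imports "HOL-Probability.Probability"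
begin

subsection \<open>Demand\<close>

definition demand_cdf :: "'a measure \<Rightarrow> ('a \<Rightarrow> real) \<Rightarrow> real \<Rightarrow> real" where
  "demand_cdf M D = cdf (distr M borel D)"

definition demand_support :: "'a measure \<Rightarrow> ('a \<Rightarrow> real) \<Rightarrow> real set" where
  "demand_support M D = {x. \<forall>\<epsilon>>0. 0 < measure (distr M borel D) (ball x \<epsilon>)}"

text \<open>Monotonicity of the generalized failure rate is required only on the interior of the support,
  where \<open>F < 1\<close> and the pointwise values of the density are determined by continuity.\<close>

locale igfr_demand = prob_space M
  for M :: "'a measure" and D :: "'a \<Rightarrow> real" and f :: "real \<Rightarrow> real" +
  assumes density: "distributed M lborel D (\<lambda>x. ennreal (f x))"
    and density_nonneg: "0 \<le> f x"
    and demand_nonneg: "AE \<omega> in M. 0 \<le> D \<omega>"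
    and support_interval: "is_interval (demand_support M D)"
    and cdf_strict_mono: "strict_mono_on (demand_support M D) (demand_cdf M D)"
    and density_continuous: "continuous_on (interior (demand_support M D)) f"
    and density_pos: "x \<in> interior (demand_support M D) \<Longrightarrow> 0 < f x"
    and igfr: "mono_on (interior (demand_support M D)) (\<lambda>d. d * f d / (1 - demand_cdf M D d))"

definition expected_sales :: "(real \<Rightarrow> real) \<Rightarrow> real \<Rightarrow> real" where
  "expected_sales f y = (LBINT x:{0..y}. x * f x) + (LBINT x:{y<..}. y * f x)"


subsection \<open>The firm\<close>

text \<open>The procurement tax rate is not a component of the record: it is the rate that varies
  in the comparative statics.\<close>

record firm =
  retail_price :: real
  material_price :: real
  effort_effect :: real
  effort_cost :: real
  markup :: real
  royalty :: real
  reservation_wage :: real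
  retail_tax :: real

definition unit_cost :: "firm \<Rightarrow> real \<Rightarrow> real" where
  "unit_cost P e = material_price P - effort_effect P * e"

definition transfer_price :: "firm \<Rightarrow> real \<Rightarrow> real" where
  "transfer_price P e = (1 + markup P) * unit_cost P e"

definition operating_efforts :: "firm \<Rightarrow> real set" where
  "operating_efforts P =
     {e. 0 \<le> e \<and> unit_cost P e \<le> transfer_price P e \<and> transfer_price P e \<le> retail_price P}"

definition retail_profit :: "firm \<Rightarrow> (real \<Rightarrow> real) \<Rightarrow> real \<Rightarrow> real \<Rightarrow> real" where
  "retail_profit P f e y = retail_price P * expected_sales f y - transfer_price P e * y"

definition optimal_order :: "firm \<Rightarrow> (real \<Rightarrow> real) \<Rightarrow> real \<Rightarrow> real \<Rightarrow> bool" where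
  "optimal_order P f e y \<longleftrightarrow> is_arg_max (retail_profit P f e) (\<lambda>y. 0 \<le> y) y"

text \<open>When the transfer price is zero and the support of demand is unbounded, no order quantity
  is optimal. Such an effort admits no continuation and is not available to the agent.\<close>

definition available_efforts :: "firm \<Rightarrow> (real \<Rightarrow> real) \<Rightarrow> real set" where
  "available_efforts P f = {e \<in> operating_efforts P. \<exists>y. optimal_order P f e y}"

text \<open>The optimal order need not be unique when the transfer price equals zero or the retail price,
  so the retail division's response is a selection \<open>Y\<close> from the optimal orders.\<close>

definition retail_response :: "firm \<Rightarrow> (real \<Rightarrow> real) \<Rightarrow> (real \<Rightarrow> real) \<Rightarrow> bool" where
  "retail_response P f Y \<longleftrightarrow> (\<forall>e \<in> available_efforts P f. optimal_order P f e (Y e))"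


subsection \<open>The contract\<close>

definition agent_payoff ::
    "firm \<Rightarrow> (real \<Rightarrow> real) \<Rightarrow> (real \<Rightarrow> real) \<Rightarrow> real \<Rightarrow> real \<Rightarrow> real \<Rightarrow> real" where
  "agent_payoff P f Y A b e = A + b * retail_profit P f e (Y e) - 1/2 * effort_cost P * e\<^sup>2"

definition agent_optimal ::
    "firm \<Rightarrow> (real \<Rightarrow> real) \<Rightarrow> (real \<Rightarrow> real) \<Rightarrow> real \<Rightarrow> real \<Rightarrow> real \<Rightarrow> bool" where
  "agent_optimal P f Y A b e \<longleftrightarrow>
     is_arg_max (agent_payoff P f Y A b) (\<lambda>e. e \<in> available_efforts P f) e"

definition hq_payoff ::
    "firm \<Rightarrow> (real \<Rightarrow> real) \<Rightarrow> (real \<Rightarrow> real) \<Rightarrow> real \<Rightarrow> real \<Rightarrow> real \<Rightarrow> real \<Rightarrow> real" where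
  "hq_payoff P f Y \<tau>\<^sub>0 A b e =
     (1 - retail_tax P) * (1 - royalty P) * retail_profit P f e (Y e)
     + (1 - \<tau>\<^sub>0) * (royalty P * retail_profit P f e (Y e) - A - b * retail_profit P f e (Y e)
                   + markup P * unit_cost P e * Y e)"

text \<open>A triple \<open>(A, b, e)\<close> consists of a contract and the effort it induces.\<close>

definition feasible_contract ::
    "firm \<Rightarrow> (real \<Rightarrow> real) \<Rightarrow> (real \<Rightarrow> real) \<Rightarrow> real \<Rightarrow> real \<Rightarrow> real \<Rightarrow> bool" where
  "feasible_contract P f Y A b e \<longleftrightarrow>
     0 \<le> b \<and> b < 1 \<and> agent_optimal P f Y A b e \<and> reservation_wage P \<le> agent_payoff P f Y A b e"

definition optimal_contract ::
    "firm \<Rightarrow> (real \<Rightarrow> real) \<Rightarrow> (real \<Rightarrow> real) \<Rightarrow> real \<Rightarrow> real \<Rightarrow> real \<Rightarrow> real \<Rightarrow> bool" where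
  "optimal_contract P f Y \<tau>\<^sub>0 A b e \<longleftrightarrow>
     is_arg_max (\<lambda>(A, b, e). hq_payoff P f Y \<tau>\<^sub>0 A b e)
       (\<lambda>(A, b, e). feasible_contract P f Y A b e) (A, b, e)"

end

theory Submission
  imports Defs
begin

text \<open>The participation constraint binds at an optimal contract, so the headquarters bears the
  whole effort cost and its payoff is a function of the induced effort \<open>e\<close> alone:
  \<open>\<rho> * \<pi> e + w * G e\<close>.  Here \<open>\<rho> = (1 - \<tau>) * (1 - \<beta>)\<close> is a positive
  constant, \<open>\<pi>\<close> is the maximal retail profit, \<open>G\<close> is the pre-tax income left on
  the procurement side, and \<open>w = 1 - \<tau> + \<Delta>\<close> is the share of it that remains after tax.
  The tax difference thus only raises the weight of \<open>G\<close> relative to \<open>\<pi>\<close>.  Since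
  \<open>\<pi>\<close> strictly increases over interior efforts, comparing two optima with each other shows that a
  larger tax difference cannot raise the effort.

  The decrease is strict because of first-order conditions.  If one interior effort were optimal
  for two weights \<open>w\<close>, then \<open>\<rho> * \<pi>' + w * G' = 0\<close> would hold for both, whence
  \<open>\<pi>' = 0\<close>.  But by the envelope argument \<open>\<pi>'\<close> is proportional to the order
  \<open>Y e\<close>, which is positive.  The intensity inherits the strict decrease, because the agent's
  effort is weakly increasing in it.

  Two points carry the first-order conditions.  First, \<open>G\<close> contains the order itself, so
  \<open>Y\<close> must be differentiable (\<open>response_differentiable\<close>): the order is a quantile of
  demand, and the distribution function has a positive derivative there.  Secondly, the
  headquarters can choose only efforts induced by some intensity, and such efforts must lie
  arbitrarily close to the optimum on both sides (\<open>induced_effort_first_order\<close>).  This holds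
  because the agent's effort is continuous in the intensity, by uniqueness of the optimal effort,
  and because distinct intensities do not share an interior effort.\<close>

section \<open>The newsvendor problem\<close>

context igfr_demand
begin

lemma random_variable_demand: "D \<in> borel_measurable M"
  using density by (simp add: distributed_def)

lemma density_measurable: "f \<in> borel_measurable borel"
  using distributed_real_measurable[OF _ density] density_nonneg by simp

lemma demand_law: "distr M borel D = density lborel f"
proof -
  have "distr M borel D = distr M lborel D"
    by (rule distr_cong) simp_all
  then show ?thesis
    using density by (simp add: distributed_def)
qed

sublocale demand_law: real_distribution "distr M borel D"
  using random_variable_demand by simp

lemma cdf_continuous: "isCont (demand_cdf M D) y"
proof -
  have "AE x in lborel. x \<noteq> y"
    by (rule AE_lborel_singleton)
  then have "AE x in distr M borel D. x \<noteq> y"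
    unfolding demand_law using density_measurable
    by (subst AE_density) auto
  then have "emeasure (distr M borel D) {y} = 0"
    by (subst (asm) AE_iff_measurable[where N="{y}"]) auto
  then have "measure (distr M borel D) {y} = 0"
    by (simp add: measure_def)
  then show ?thesis
    unfolding demand_cdf_def by (simp add: demand_law.isCont_cdf)
qed

lemma cdf_mono: "x \<le> y \<Longrightarrow> demand_cdf M D x \<le> demand_cdf M D y"
  unfolding demand_cdf_def by (rule demand_law.cdf_nondecreasing)

text \<open>Demand has no mass below zero, and its law has no atom at zero.\<close>

lemma cdf_zero: "demand_cdf M D 0 = 0"
proof -
  have cdf_neg: "demand_cdf M D y = 0" if "y < 0" for y
  proof -
    have "AE \<omega> in M. \<omega> \<notin> D -` {..y} \<inter> space M"
      using demand_nonneg that by (auto elim: AE_mp)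
    then have "prob (D -` {..y} \<inter> space M) = 0"
      using random_variable_demand by (subst prob_eq_0) auto
    then show ?thesis
      unfolding demand_cdf_def cdf_def using random_variable_demand
      by (subst measure_distr) auto
  qed
  have "(demand_cdf M D \<longlongrightarrow> demand_cdf M D 0) (at_left 0)"
    using cdf_continuous[of 0] by (simp add: isCont_def filterlim_at_split)
  moreover have "(demand_cdf M D \<longlongrightarrow> 0) (at_left 0)"
    by (rule tendsto_eventually) (auto simp: eventually_at_filter cdf_neg)
  ultimately show ?thesis
    using tendsto_unique trivial_limit_at_left_real by blast
qed

lemma tail_probability: "measure (distr M borel D) {y<..} = 1 - demand_cdf M D y"
proof -
  have "{y<..} = space (distr M borel D) - {..y}" by auto
  then show ?thesis
    unfolding demand_cdf_def cdf_def using demand_law.prob_compl[of "{..y}"] by simp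
qed

lemma cdf_attains:
  assumes "0 < p" "p < 1"
  obtains y where "0 \<le> y" "demand_cdf M D y = p"
proof -
  have "(demand_cdf M D \<longlongrightarrow> 1) at_top"
    unfolding demand_cdf_def by (rule demand_law.cdf_lim_at_top_prob)
  then have "eventually (\<lambda>y. p < demand_cdf M D y \<and> 0 \<le> y) at_top"
    using assms by (intro eventually_conj order_tendstoD eventually_ge_at_top) auto
  then obtain z where "p < demand_cdf M D z" "0 \<le> z"
    by (auto simp: eventually_at_top_linorder)
  then show ?thesis
    using IVT[of "demand_cdf M D" 0 p z] cdf_zero assms cdf_continuous that by auto
qed

lemma expected_sales_eq_expectation:
  assumes "0 \<le> y"
  shows "expected_sales f y = (\<integral>x. max 0 (min x y) \<partial>distr M borel D)"
proof -
  have fint: "integrable lborel f"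
    using density_measurable density_nonneg
      demand_law.emeasure_space_1
    unfolding demand_law
    by (intro integrableI_nonneg) (auto simp: emeasure_density)
  have i1: "integrable lborel (\<lambda>x. indicator {0..y} x *\<^sub>R (x * f x))"
    by (rule Bochner_Integration.integrable_bound[OF integrable_mult_right[OF fint, of y]])
      (use density_measurable density_nonneg assms in
        \<open>auto simp: indicator_def abs_mult intro!: mult_right_mono\<close>)
  have i2: "integrable lborel (\<lambda>x. indicator {y<..} x *\<^sub>R (y * f x))"
    by (rule Bochner_Integration.integrable_bound[OF integrable_mult_right[OF fint, of y]])
      (use density_measurable density_nonneg assms in \<open>auto simp: indicator_def\<close>)
  have "expected_sales f y
      = (\<integral>x. indicator {0..y} x *\<^sub>R (x * f x) + indicator {y<..} x *\<^sub>R (y * f x) \<partial>lborel)"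
    unfolding expected_sales_def set_lebesgue_integral_def
    using i1 i2 by simp
  also have "\<dots> = (\<integral>x. f x * max 0 (min x y) \<partial>lborel)"
    using assms by (intro Bochner_Integration.integral_cong) (auto simp: indicator_def)
  also have "\<dots> = (\<integral>x. max 0 (min x y) \<partial>distr M borel D)"
    unfolding demand_law using density_measurable density_nonneg
    by (subst integral_real_density) auto
  finally show ?thesis .
qed

text \<open>A further unit between \<open>y\<close> and \<open>y'\<close> is sold for certain when demand exceeds \<open>y'\<close>,
  and can be sold only when demand exceeds \<open>y\<close>.  So the marginal sale is the tail
  probability, and these bounds stand in for the derivative of expected sales.\<close>

lemma expected_sales_increment:
  assumes "0 \<le> y" "y \<le> y'"
  shows "(y' - y) * (1 - demand_cdf M D y') \<le> expected_sales f y' - expected_sales f y"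
    and "expected_sales f y' - expected_sales f y \<le> (y' - y) * (1 - demand_cdf M D y)"
proof -
  let ?\<mu> = "distr M borel D"
  have sales_int: "integrable ?\<mu> (\<lambda>x. max 0 (min x z))" if "0 \<le> z" for z :: real
    by (rule demand_law.integrable_const_bound[where B=z]) (use that in auto)
  have ind_int: "integrable ?\<mu> (\<lambda>x. (y' - y) * indicator {z<..} x)" for z :: real
    by (intro integrable_mult_right)
      (auto intro: integrable_real_indicator simp: demand_law.emeasure_finite less_top[symmetric])
  have ind: "(\<integral>x. (y' - y) * indicator {z<..} x \<partial>?\<mu>) = (y' - y) * (1 - demand_cdf M D z)" for z
    by (simp add: tail_probability)
  have diff: "expected_sales f y' - expected_sales f y
      = (\<integral>x. max 0 (min x y') - max 0 (min x y) \<partial>?\<mu>)"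
    using assms sales_int by (simp add: expected_sales_eq_expectation)
  show "(y' - y) * (1 - demand_cdf M D y') \<le> expected_sales f y' - expected_sales f y"
    unfolding diff ind[symmetric]
    by (rule integral_mono) (use assms sales_int ind_int in \<open>auto simp: indicator_def\<close>)
  show "expected_sales f y' - expected_sales f y \<le> (y' - y) * (1 - demand_cdf M D y)"
    unfolding diff ind[symmetric]
    by (rule integral_mono) (use assms sales_int ind_int in \<open>auto simp: indicator_def\<close>)
qed

text \<open>The order equates the marginal revenue \<open>m * (1 - F y)\<close> to the unit price \<open>t\<close>.
  The corner \<open>y = 0\<close> is no exception, since \<open>F 0 = 0\<close> makes the first unit
  profitable.\<close>

lemma newsvendor_optimal_iff:
  assumes "0 < t" "t < m"
  shows "is_arg_max (\<lambda>y. m * expected_sales f y - t * y) (\<lambda>y. 0 \<le> y) y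
    \<longleftrightarrow> 0 \<le> y \<and> demand_cdf M D y = 1 - t / m"
proof
  let ?F = "demand_cdf M D" and ?s = "expected_sales f"
  have m: "0 < m" using assms by simp
  {
    assume opt: "is_arg_max (\<lambda>y. m * ?s y - t * y) (\<lambda>y. 0 \<le> y) y"
    then have y: "0 \<le> y" and best: "\<And>z. 0 \<le> z \<Longrightarrow> m * ?s z - t * z \<le> m * ?s y - t * y"
      by (auto simp: is_arg_max_linorder)
    have right: "1 - t / m \<le> ?F z" if "y < z" for z
    proof -
      have "m * ((z - y) * (1 - ?F z)) \<le> m * (?s z - ?s y)"
        using expected_sales_increment(1)[of y z] y that m by (intro mult_left_mono) auto
      also have "\<dots> \<le> t * (z - y)"
        using best[of z] y that by (simp add: algebra_simps)
      finally have "(z - y) * (m * (1 - ?F z)) \<le> (z - y) * t"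
        by (simp add: algebra_simps)
      then have "m * (1 - ?F z) \<le> t" using that by simp
      then show ?thesis using m by (simp add: field_simps)
    qed
    have left: "?F z \<le> 1 - t / m" if "0 \<le> z" "z < y" for z
    proof -
      have "t * (y - z) \<le> m * (?s y - ?s z)"
        using best[of z] that by (simp add: algebra_simps)
      also have "\<dots> \<le> m * ((y - z) * (1 - ?F z))"
        using expected_sales_increment(2)[of z y] that m by (intro mult_left_mono) auto
      finally have "(y - z) * t \<le> (y - z) * (m * (1 - ?F z))"
        by (simp add: algebra_simps)
      then have "t \<le> m * (1 - ?F z)" using that by simp
      then show ?thesis using m by (simp add: field_simps)
    qed
    have lims: "(?F \<longlongrightarrow> ?F y) (at_right y)" "(?F \<longlongrightarrow> ?F y) (at_left y)"
      using cdf_continuous[of y] by (simp_all add: isCont_def filterlim_at_split)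
    have ge: "1 - t / m \<le> ?F y"
      by (rule tendsto_lowerbound[OF lims(1)])
        (auto simp: eventually_at_filter right)
    then have "0 < y"
      using y cdf_zero assms by (cases "y = 0") (auto simp: field_simps)
    then have "eventually (\<lambda>z. z \<in> {0<..<y}) (at_left y)"
      by (rule eventually_at_left_real)
    then have "eventually (\<lambda>z. ?F z \<le> 1 - t / m) (at_left y)"
      by eventually_elim (use left in auto)
    then have "?F y \<le> 1 - t / m"
      by (rule tendsto_upperbound[OF lims(2)]) simp
    then show "0 \<le> y \<and> ?F y = 1 - t / m"
      using y ge by simp
  next
    assume "0 \<le> y \<and> ?F y = 1 - t / m"
    then have y: "0 \<le> y" and tail: "m * (1 - ?F y) = t"
      using m by (auto simp: field_simps)
    have "m * ?s z - t * z \<le> m * ?s y - t * y" if z: "0 \<le> z" for z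
    proof (cases "y \<le> z")
      case True
      have "m * (?s z - ?s y) \<le> m * ((z - y) * (1 - ?F y))"
        using expected_sales_increment(2)[of y z] y True m by (intro mult_left_mono) auto
      also have "\<dots> = t * (z - y)" using tail by (metis mult.left_commute mult.commute)
      finally show ?thesis by (simp add: algebra_simps)
    next
      case False
      have "t * (y - z) = m * ((y - z) * (1 - ?F y))"
        using tail by (metis mult.left_commute mult.commute)
      also have "\<dots> \<le> m * (?s y - ?s z)"
        using expected_sales_increment(1)[of z y] z False m by (intro mult_left_mono) auto
      finally show ?thesis by (simp add: algebra_simps)
    qed
    then show "is_arg_max (\<lambda>y. m * ?s y - t * y) (\<lambda>y. 0 \<le> y) y"
      using y by (simp add: is_arg_max_linorder)
  }
qed

text \<open>Every point off the support has a null neighbourhood, and by the Lindelof property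
  countably many of these cover the complement.\<close>

lemma null_off_support:
  assumes "A \<inter> demand_support M D = {}" "A \<in> sets borel"
  shows "measure (distr M borel D) A = 0"
proof -
  let ?\<mu> = "distr M borel D"
  let ?B = "{B. open B \<and> measure ?\<mu> B = 0}"
  obtain \<B> where \<B>: "\<B> \<subseteq> ?B" "countable \<B>" "\<Union>\<B> = \<Union>?B"
    using Lindelof[of ?B] by auto
  have null: "\<Union>\<B> \<in> null_sets ?\<mu>"
  proof -
    have "B \<in> null_sets ?\<mu>" if "B \<in> \<B>" for B
      using \<B>(1) that by (intro null_setsI) (auto simp: demand_law.emeasure_eq_measure)
    then show ?thesis
      using \<B>(2) null_sets_UN'[of \<B> "\<lambda>B. B"] by simp
  qed
  have sub: "A \<subseteq> \<Union>\<B>"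
  proof
    fix x assume "x \<in> A"
    then have "x \<notin> demand_support M D" using assms by auto
    then obtain \<epsilon> where "0 < \<epsilon>" "\<not> 0 < measure ?\<mu> (ball x \<epsilon>)"
      by (auto simp: demand_support_def)
    then have "ball x \<epsilon> \<in> ?B" "x \<in> ball x \<epsilon>"
      by (auto simp: not_less measure_le_0_iff)
    then show "x \<in> \<Union>\<B>" unfolding \<B>(3) by blast
  qed
  have "A \<in> null_sets ?\<mu>"
    by (rule null_sets_subset[OF null _ sub]) (use assms(2) in simp)
  then show ?thesis
    by (simp add: demand_law.emeasure_eq_measure null_sets_def)
qed

text \<open>There is mass strictly on either side of \<open>y\<close>, so the support, being an interval,
  surrounds it.\<close>

lemma interior_support_if_cdf_between:
  assumes "0 < demand_cdf M D y" "demand_cdf M D y < 1"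
  shows "y \<in> interior (demand_support M D)"
proof -
  let ?supp = "demand_support M D"
  have "\<forall>\<^sub>F z in at_left y. 0 < demand_cdf M D z"
    using cdf_continuous[of y] assms(1)
    by (intro order_tendstoD(1)) (auto simp: isCont_def filterlim_at_split)
  moreover have "\<forall>\<^sub>F z in at_left y. z < y"
    by (auto simp: eventually_at_filter)
  ultimately have "\<forall>\<^sub>F z in at_left y. 0 < demand_cdf M D z \<and> z < y"
    by (rule eventually_conj)
  then obtain z where z: "0 < demand_cdf M D z" "z < y"
    using eventually_happens'[OF trivial_limit_at_left_real] by blast
  have "{..z} \<inter> ?supp \<noteq> {}"
    using z null_off_support[of "{..z}"] by (auto simp: demand_cdf_def cdf_def)
  then obtain p where p: "p \<in> ?supp" "p < y" using \<open>z < y\<close> by force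
  have "{y<..} \<inter> ?supp \<noteq> {}"
    using assms(2) null_off_support[of "{y<..}"] by (auto simp: tail_probability)
  then obtain q where q: "q \<in> ?supp" "y < q" by auto
  have "{p<..<q} \<subseteq> ?supp"
    using support_interval p q unfolding is_interval_1
    by (meson greaterThanLessThan_iff less_imp_le subsetI)
  then show ?thesis
    using p q by (intro interiorI[of "{p<..<q}"]) auto
qed

lemma cdf_increment:
  assumes "a \<le> y"
  shows "demand_cdf M D y - demand_cdf M D a = integral {a..y} f"
proof -
  have "integral {a..y} f = measure (distr M borel D) {a..y}"
  proof -
    have "(\<integral>\<^sup>+ x. ennreal (f x) * indicator {a..y} x \<partial>lborel) = emeasure (distr M borel D) {a..y}"
      unfolding demand_law using density_measurable by (subst emeasure_density) auto
    then have "(\<integral>\<^sup>+ x. ennreal (f x) * indicator {a..y} x \<partial>lborel) = ennreal (measure (distr M borel D) {a..y})"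
      by (simp add: demand_law.emeasure_eq_measure)
    then have "((\<lambda>x. f x * indicator {a..y} x) has_integral measure (distr M borel D) {a..y}) UNIV"
      using density_measurable density_nonneg
      by (intro nn_integral_has_integral) (auto simp: ennreal_mult' ennreal_indicator)
    moreover have "(\<lambda>x. f x * indicator {a..y} x) = (\<lambda>x. if x \<in> {a..y} then f x else 0)"
      by (auto simp: indicator_def)
    ultimately show ?thesis
      by (metis has_integral_restrict_UNIV integral_unique)
  qed
  moreover have "measure (distr M borel D) {a..y} = demand_cdf M D y - demand_cdf M D a"
  proof -
    have "measure (distr M borel D) {a} = 0"
      using cdf_continuous[of a] unfolding demand_cdf_def by (simp add: demand_law.isCont_cdf)
    moreover have "measure (distr M borel D) ({a} \<union> {a<..y}) = measure (distr M borel D) {a} + measure (distr M borel D) {a<..y}"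
      by (rule demand_law.finite_measure_Union) auto
    moreover have "{a} \<union> {a<..y} = {a..y}" using assms by auto
    moreover have "measure (distr M borel D) {a<..y} = demand_cdf M D y - demand_cdf M D a"
      using assms demand_law.cdf_diff_eq[of a y] by (cases "a = y") (auto simp: demand_cdf_def)
    ultimately show ?thesis by simp
  qed
  ultimately show ?thesis by simp
qed

lemma cdf_has_density_derivative:
  assumes "y \<in> interior (demand_support M D)"
  shows "(demand_cdf M D has_real_derivative f y) (at y)"
proof -
  obtain \<epsilon> where \<epsilon>: "0 < \<epsilon>" "cball y \<epsilon> \<subseteq> interior (demand_support M D)"
    using assms open_contains_cball[of "interior (demand_support M D)"] by auto
  let ?I = "{y - \<epsilon>..y + \<epsilon>}"
  have I: "?I \<subseteq> interior (demand_support M D)" using \<epsilon>(2) by (simp add: cball_eq_atLeastAtMost)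
  have "((\<lambda>x. integral {y - \<epsilon>..x} f) has_real_derivative f y) (at y within ?I)"
    using \<epsilon>(1) I by (intro integral_has_real_derivative continuous_on_subset[OF density_continuous]) auto
  then have "((\<lambda>x. integral {y - \<epsilon>..x} f) has_real_derivative f y) (at y)"
    using \<epsilon>(1) by (simp add: at_within_Icc_at)
  then have "((\<lambda>x. demand_cdf M D (y - \<epsilon>) + integral {y - \<epsilon>..x} f) has_real_derivative f y) (at y)"
    by (auto intro!: derivative_eq_intros)
  then show ?thesis
  proof (rule has_field_derivative_transform_within[OF _ \<epsilon>(1)])
    fix x assume "dist x y < \<epsilon>"
    then have "y - \<epsilon> \<le> x" by (auto simp: dist_real_def)
    then show "demand_cdf M D (y - \<epsilon>) + integral {y - \<epsilon>..x} f = demand_cdf M D x"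
      using cdf_increment[of "y - \<epsilon>" x] by simp
  qed simp
qed

end


section \<open>The retail division's response\<close>

locale limited_risk_firm = igfr_demand M D f
  for M :: "'a measure" and D :: "'a \<Rightarrow> real" and f :: "real \<Rightarrow> real" +
  fixes P :: firm and Y :: "real \<Rightarrow> real"
  assumes retail_price_pos: "0 < retail_price P"
    and effort_effect_pos: "0 < effort_effect P"
    and effort_cost_pos: "0 < effort_cost P"
    and markup_pos: "0 < markup P"
    and royalty_less_one: "royalty P < 1"
    and retail_tax_less_one: "retail_tax P < 1"
    and response: "retail_response P f Y"
    and agent_unique: "0 \<le> b \<Longrightarrow> b < 1 \<Longrightarrow> \<exists>!e. agent_optimal P f Y A b e"
begin

abbreviation "slope \<equiv> (1 + markup P) * effort_effect P"
abbreviation "profit e \<equiv> retail_profit P f e (Y e)"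
abbreviation "available \<equiv> available_efforts P f"

lemma slope_pos: "0 < slope"
  using markup_pos effort_effect_pos by simp

lemma transfer_price_change: "transfer_price P x = transfer_price P e - slope * (x - e)"
  by (simp add: transfer_price_def unit_cost_def algebra_simps)

lemma operating_efforts_iff:
  "e \<in> operating_efforts P \<longleftrightarrow> 0 \<le> e \<and> 0 \<le> transfer_price P e \<and> transfer_price P e \<le> retail_price P"
proof -
  have "unit_cost P e \<le> transfer_price P e \<longleftrightarrow> 0 \<le> unit_cost P e"
    using markup_pos by (simp add: transfer_price_def algebra_simps zero_le_mult_iff)
  moreover have "0 \<le> transfer_price P e \<longleftrightarrow> 0 \<le> unit_cost P e"
    using markup_pos by (simp add: transfer_price_def zero_le_mult_iff)
  ultimately show ?thesis by (simp add: operating_efforts_def)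
qed

lemma interior_operating_efforts:
  assumes "e \<in> interior (operating_efforts P)"
  shows "0 \<le> e" "0 < transfer_price P e" "transfer_price P e < retail_price P"
proof -
  obtain \<epsilon> where \<epsilon>: "0 < \<epsilon>" "cball e \<epsilon> \<subseteq> operating_efforts P"
    using assms by (auto simp: mem_interior_cball)
  then have "e \<in> operating_efforts P" "e - \<epsilon> \<in> operating_efforts P" "e + \<epsilon> \<in> operating_efforts P"
    by (auto simp: cball_eq_atLeastAtMost subset_iff)
  moreover have "0 < slope * \<epsilon>"
    using slope_pos \<epsilon>(1) by (rule mult_pos_pos)
  ultimately show "0 \<le> e" "0 < transfer_price P e" "transfer_price P e < retail_price P"
    using transfer_price_change[of "e - \<epsilon>" e] transfer_price_change[of "e + \<epsilon>" e]
    unfolding operating_efforts_iff by (simp_all add: algebra_simps)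
qed

lemma response_optimal:
  assumes "e \<in> available"
  shows "0 \<le> Y e" and "0 \<le> y \<Longrightarrow> retail_profit P f e y \<le> profit e"
  using response assms
  by (auto simp: retail_response_def optimal_order_def is_arg_max_linorder)

lemma optimal_order_iff:
  assumes "0 < transfer_price P e" "transfer_price P e < retail_price P"
  shows "optimal_order P f e y
    \<longleftrightarrow> 0 \<le> y \<and> demand_cdf M D y = 1 - transfer_price P e / retail_price P"
proof -
  have "retail_profit P f e = (\<lambda>y. retail_price P * expected_sales f y - transfer_price P e * y)"
    by (rule ext) (simp add: retail_profit_def)
  then show ?thesis
    using newsvendor_optimal_iff[OF assms] by (simp add: optimal_order_def)
qed

lemma available_if_price_between:
  assumes "0 \<le> e" "0 < transfer_price P e" "transfer_price P e < retail_price P"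
  shows "e \<in> available"
proof -
  let ?t = "transfer_price P e" and ?m = "retail_price P"
  obtain y where "0 \<le> y" "demand_cdf M D y = 1 - ?t / ?m"
    using assms by (elim cdf_attains[of "1 - ?t / ?m", rotated 2]) (auto simp: field_simps)
  then have "optimal_order P f e y"
    using optimal_order_iff assms by simp
  then show ?thesis
    using assms by (auto simp: available_efforts_def operating_efforts_iff)
qed

lemma response_fractile:
  assumes "0 \<le> e" "0 < transfer_price P e" "transfer_price P e < retail_price P"
  shows "demand_cdf M D (Y e) = 1 - transfer_price P e / retail_price P"
proof -
  have "optimal_order P f e (Y e)"
    using response available_if_price_between[OF assms] by (simp add: retail_response_def)
  then show ?thesis
    using optimal_order_iff assms by simp
qed

lemma response_fractile_between:
  assumes "e \<in> interior (operating_efforts P)"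
  shows "0 < demand_cdf M D (Y e)" "demand_cdf M D (Y e) < 1"
proof -
  note e = interior_operating_efforts[OF assms]
  have "0 < transfer_price P e / retail_price P" "transfer_price P e / retail_price P < 1"
    using e by simp_all
  then show "0 < demand_cdf M D (Y e)" "demand_cdf M D (Y e) < 1"
    using response_fractile[OF e] by simp_all
qed

lemma response_pos:
  assumes "e \<in> interior (operating_efforts P)"
  shows "0 < Y e"
proof -
  note e = interior_operating_efforts[OF assms]
  have "Y e \<noteq> 0"
    using response_fractile_between(1)[OF assms] cdf_zero by auto
  then show ?thesis
    using response_optimal(1)[OF available_if_price_between[OF e]] by simp
qed

text \<open>An effort strictly between two operating ones puts the transfer price strictly between
  zero and the retail price, where an optimal order exists.\<close>

lemma available_between:
  assumes "e\<^sub>1 \<in> available" "e\<^sub>2 \<in> available" "e\<^sub>1 \<le> e" "e \<le> e\<^sub>2"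
  shows "e \<in> available"
proof (cases "e = e\<^sub>1 \<or> e = e\<^sub>2")
  case False
  have op: "e\<^sub>1 \<in> operating_efforts P" "e\<^sub>2 \<in> operating_efforts P"
    using assms by (auto simp: available_efforts_def)
  have "0 < slope * (e - e\<^sub>1)" "0 < slope * (e\<^sub>2 - e)"
    using False assms by (intro mult_pos_pos slope_pos; simp)+
  then have "0 < transfer_price P e" "transfer_price P e < retail_price P"
    using op transfer_price_change[of e e\<^sub>1] transfer_price_change[of e\<^sub>2 e]
    unfolding operating_efforts_iff by linarith+
  then show ?thesis
    using available_if_price_between op assms unfolding operating_efforts_iff by auto
qed (use assms in auto)

text \<open>After effort \<open>x\<close>, the retail division could still place the order that is best after
  effort \<open>e\<close>, and would then gain exactly the cut in the transfer price on every unit ordered.\<close>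

lemma profit_supporting_line:
  assumes "e \<in> available" "x \<in> available"
  shows "slope * Y e * (x - e) \<le> profit x - profit e"
proof -
  have "retail_profit P f x (Y e) = profit e + slope * Y e * (x - e)"
    unfolding retail_profit_def transfer_price_change[of x e] by (simp add: algebra_simps)
  then show ?thesis
    using response_optimal[OF assms(2)] response_optimal(1)[OF assms(1)] by (smt (verit))
qed

lemma response_mono:
  assumes "e \<in> available" "x \<in> available" "e \<le> x"
  shows "Y e \<le> Y x"
proof (cases "e = x")
  case False
  have "slope * Y e * (x - e) \<le> slope * Y x * (x - e)"
    using profit_supporting_line[OF assms(1,2)] profit_supporting_line[OF assms(2,1)]
    by (simp add: algebra_simps)
  then show ?thesis
    using False assms(3) slope_pos by (simp add: mult_le_cancel_right mult_le_cancel_left)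
qed simp

lemma profit_lipschitz:
  assumes "e \<in> available" "x \<in> available" "z \<in> available" "e \<le> z" "x \<le> z"
  shows "\<bar>profit x - profit e\<bar> \<le> slope * Y z * \<bar>x - e\<bar>"
proof -
  have bound: "profit v - profit u \<le> slope * Y z * \<bar>v - u\<bar>"
    if "u \<in> available" "v \<in> available" "v \<le> z" for u v
  proof -
    have "profit v - profit u \<le> slope * Y v * (v - u)"
      using profit_supporting_line[OF that(2,1)] by (simp add: algebra_simps)
    also have "\<dots> \<le> slope * Y v * \<bar>v - u\<bar>"
      using slope_pos response_optimal(1)[OF that(2)] by (intro mult_left_mono) auto
    also have "\<dots> \<le> slope * Y z * \<bar>v - u\<bar>"
      using slope_pos response_mono[OF that(2) assms(3) that(3)]
      by (intro mult_right_mono mult_left_mono) auto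
    finally show ?thesis .
  qed
  show ?thesis
    using bound[of e x] bound[of x e] assms by (simp add: abs_minus_commute abs_le_iff)
qed

lemma eventually_interior:
  assumes "e \<in> interior (operating_efforts P)"
  shows "\<forall>\<^sub>F x in at e. x \<in> interior (operating_efforts P)"
  using assms eventually_at_in_open'[of "interior (operating_efforts P)" e] by simp

text \<open>The order solves \<open>F (Y e) = 1 - t e / m\<close>, whose right-hand side is affine in
  effort and where \<open>F\<close> has the positive derivative \<open>f (Y e)\<close>.\<close>

lemma response_differentiable:
  assumes "e \<in> interior (operating_efforts P)"
  obtains c where "(Y has_real_derivative c) (at e)"
proof -
  let ?F = "demand_cdf M D" and ?m = "retail_price P" and ?U = "interior (operating_efforts P)"
  define r where "r = slope / ?m"
  have r: "0 < r" using slope_pos retail_price_pos by (simp add: r_def)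
  have fractile: "?F (Y x) = 1 - transfer_price P x / ?m" if "x \<in> ?U" for x
    using interior_operating_efforts[OF that] by (rule response_fractile)
  have change: "?F (Y x) - ?F (Y e) = r * (x - e)" if "x \<in> ?U" for x
    using fractile[OF that] fractile[OF assms] transfer_price_change[of x e] retail_price_pos
    by (simp add: r_def field_simps)
  have y: "Y e \<in> interior (demand_support M D)"
    using response_fractile_between[OF assms] by (rule interior_support_if_cdf_between)
  note F' = cdf_has_density_derivative[OF y] and f_pos = density_pos[OF y]
  have tendsto: "(\<lambda>x. ?F (Y x)) \<midarrow>e\<rightarrow> ?F (Y e)"
  proof (rule Lim_transform_eventually)
    have "(\<lambda>x. ?F (Y e) + r * (x - e)) \<midarrow>e\<rightarrow> ?F (Y e) + r * (e - e)"
      by (intro tendsto_intros)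
    then show "(\<lambda>x. ?F (Y e) + r * (x - e)) \<midarrow>e\<rightarrow> ?F (Y e)"
      by simp
    show "\<forall>\<^sub>F x in at e. ?F (Y e) + r * (x - e) = ?F (Y x)"
      using eventually_interior[OF assms] by eventually_elim (use change in \<open>simp add: algebra_simps\<close>)
  qed
  obtain \<delta>\<^sub>1 where \<delta>\<^sub>1: "0 < \<delta>\<^sub>1" "\<And>h. 0 < h \<Longrightarrow> h < \<delta>\<^sub>1 \<Longrightarrow> ?F (Y e) < ?F (Y e + h)"
    using DERIV_pos_inc_right[OF F' f_pos] by blast
  obtain \<delta>\<^sub>2 where \<delta>\<^sub>2: "0 < \<delta>\<^sub>2" "\<And>h. 0 < h \<Longrightarrow> h < \<delta>\<^sub>2 \<Longrightarrow> ?F (Y e - h) < ?F (Y e)"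
    using DERIV_pos_inc_left[OF F' f_pos] by blast
  have Y_cont: "isCont Y e"
    unfolding isCont_def
  proof (rule order_tendstoI)
    fix a assume a: "a < Y e"
    define h where "h = min (\<delta>\<^sub>2 / 2) (Y e - a)"
    have h: "0 < h" "h < \<delta>\<^sub>2" "a \<le> Y e - h" using a \<delta>\<^sub>2(1) by (auto simp: h_def)
    have "\<forall>\<^sub>F x in at e. ?F (Y e - h) < ?F (Y x)"
      using tendsto \<delta>\<^sub>2(2)[OF h(1,2)] by (rule order_tendstoD)
    then show "\<forall>\<^sub>F x in at e. a < Y x"
      by eventually_elim (use cdf_mono h(3) in \<open>smt (verit)\<close>)
  next
    fix a assume a: "Y e < a"
    define h where "h = min (\<delta>\<^sub>1 / 2) (a - Y e)"
    have h: "0 < h" "h < \<delta>\<^sub>1" "Y e + h \<le> a" using a \<delta>\<^sub>1(1) by (auto simp: h_def)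
    have "\<forall>\<^sub>F x in at e. ?F (Y x) < ?F (Y e + h)"
      using tendsto \<delta>\<^sub>1(2)[OF h(1,2)] by (rule order_tendstoD)
    then show "\<forall>\<^sub>F x in at e. Y x < a"
      by eventually_elim (use cdf_mono h(3) in \<open>smt (verit)\<close>)
  qed
  obtain g where g: "\<And>z. ?F z - ?F (Y e) = g z * (z - Y e)" "isCont g (Y e)" "g (Y e) = f (Y e)"
    using F' by (auto simp: CARAT_DERIV)
  have "(\<lambda>x. r / g (Y x)) \<midarrow>e\<rightarrow> r / f (Y e)"
    using isCont_tendsto_compose[OF g(2) Y_cont[unfolded isCont_def]] f_pos g(3)
    by (intro tendsto_intros) auto
  moreover have "\<forall>\<^sub>F x in at e. r / g (Y x) = (Y x - Y e) / (x - e)"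
  proof -
    have "\<forall>\<^sub>F x in at e. x \<noteq> e" by (simp add: eventually_at_filter)
    with eventually_interior[OF assms] show ?thesis
    proof eventually_elim
      case (elim x)
      then have "g (Y x) * (Y x - Y e) = r * (x - e)"
        using g(1)[of "Y x"] change by simp
      moreover from this have "g (Y x) \<noteq> 0" using r elim by auto
      ultimately show ?case using elim by (simp add: divide_eq_eq eq_divide_eq mult.commute)
    qed
  qed
  ultimately have "(\<lambda>x. (Y x - Y e) / (x - e)) \<midarrow>e\<rightarrow> r / f (Y e)"
    by (rule Lim_transform_eventually)
  then show thesis
    by (intro that) (simp add: has_field_derivative_iff)
qed

text \<open>The supporting lines at \<open>e\<close> and at a nearby \<open>x\<close> enclose the difference
  quotient between \<open>slope * Y e\<close> and \<open>slope * Y x\<close>.\<close>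

lemma profit_has_derivative:
  assumes "e \<in> interior (operating_efforts P)"
  shows "(profit has_real_derivative slope * Y e) (at e)"
proof -
  have "isCont Y e"
    using response_differentiable[OF assms] DERIV_isCont by blast
  then have lim: "(\<lambda>x. slope * \<bar>Y x - Y e\<bar>) \<midarrow>e\<rightarrow> 0"
    unfolding isCont_def by (auto intro!: tendsto_eq_intros)
  have e: "e \<in> available"
    using interior_operating_efforts[OF assms] by (rule available_if_price_between)
  have "(\<lambda>x. (profit x - profit e) / (x - e) - slope * Y e) \<midarrow>e\<rightarrow> 0"
  proof (rule Lim_null_comparison[OF _ lim])
    have "\<forall>\<^sub>F x in at e. x \<noteq> e" by (simp add: eventually_at_filter)
    with eventually_interior[OF assms]
    show "\<forall>\<^sub>F x in at e. norm ((profit x - profit e) / (x - e) - slope * Y e) \<le> slope * \<bar>Y x - Y e\<bar>"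
    proof eventually_elim
      case (elim x)
      have x: "x \<in> available"
        using interior_operating_efforts[OF elim(1)] by (rule available_if_price_between)
      have lo: "0 \<le> profit x - profit e - slope * Y e * (x - e)"
        using profit_supporting_line[OF e x] by simp
      have "profit x - profit e - slope * Y e * (x - e) \<le> slope * (Y x - Y e) * (x - e)"
        using profit_supporting_line[OF x e] by (simp add: algebra_simps)
      also have "\<dots> \<le> \<bar>slope * (Y x - Y e) * (x - e)\<bar>" by (rule abs_ge_self)
      also have "\<dots> = slope * \<bar>Y x - Y e\<bar> * \<bar>x - e\<bar>"
        using markup_pos effort_effect_pos by (simp add: abs_mult)
      finally have "\<bar>profit x - profit e - slope * Y e * (x - e)\<bar> \<le> slope * \<bar>Y x - Y e\<bar> * \<bar>x - e\<bar>"
        using lo by simp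
      moreover have "(profit x - profit e) / (x - e) - slope * Y e
          = (profit x - profit e - slope * Y e * (x - e)) / (x - e)"
        using elim by (simp add: field_simps)
      ultimately show ?case
        using elim by (simp add: abs_divide divide_le_eq)
    qed
  qed
  then show ?thesis
    by (simp add: has_field_derivative_iff LIM_zero_iff)
qed


section \<open>The agent's effort\<close>

lemma agent_optimal_iff:
  "agent_optimal P f Y A b e \<longleftrightarrow> e \<in> available \<and> (\<forall>x \<in> available.
    b * profit x - effort_cost P / 2 * x\<^sup>2 \<le> b * profit e - effort_cost P / 2 * e\<^sup>2)"
  by (auto simp: agent_optimal_def is_arg_max_linorder agent_payoff_def)

text \<open>The fixed payment does not affect the choice of effort, so it is normalised to zero.\<close>

definition effort :: "real \<Rightarrow> real" where
  "effort b = (THE e. agent_optimal P f Y 0 b e)"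

lemma agent_optimal_eq_effort:
  assumes "0 \<le> b" "b < 1"
  shows "agent_optimal P f Y A b e \<longleftrightarrow> e = effort b"
proof -
  have "agent_optimal P f Y 0 b (effort b)"
    unfolding effort_def by (rule theI') (rule agent_unique[OF assms])
  moreover have "agent_optimal P f Y A b e \<longleftrightarrow> agent_optimal P f Y 0 b e"
    by (simp add: agent_optimal_iff)
  ultimately show ?thesis
    using agent_unique[OF assms] by blast
qed

lemma effort_available: "0 \<le> b \<Longrightarrow> b < 1 \<Longrightarrow> effort b \<in> available"
  using agent_optimal_eq_effort agent_optimal_iff by blast

lemma effort_maximal:
  assumes "0 \<le> b" "b < 1" "x \<in> available"
  shows "b * profit x - effort_cost P / 2 * x\<^sup>2
    \<le> b * profit (effort b) - effort_cost P / 2 * (effort b)\<^sup>2"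
  using assms agent_optimal_eq_effort agent_optimal_iff by blast

text \<open>Revealed preference gives a weakly larger profit at the higher intensity.  This orders the
  efforts even where orders are zero and the profit is flat, because an agent never bears a
  higher effort cost for the same profit.\<close>

lemma effort_mono:
  assumes "0 \<le> b" "b \<le> b'" "b' < 1"
  shows "effort b \<le> effort b'"
proof (rule ccontr)
  let ?e = "effort b" and ?e' = "effort b'"
  assume "\<not> ?e \<le> ?e'"
  then have less: "?e' < ?e" by simp
  then have "b < b'" using assms by (cases "b = b'") auto
  have av: "?e \<in> available" "?e' \<in> available" using assms effort_available by auto
  have "0 \<le> slope * Y ?e' * (?e - ?e')"
    using slope_pos response_optimal(1)[OF av(2)] less by simp
  then have ge: "profit ?e' \<le> profit ?e"
    using profit_supporting_line[OF av(2,1)] by simp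
  have "0 \<le> ?e'" using av by (auto simp: available_efforts_def operating_efforts_iff)
  then have "effort_cost P / 2 * ?e'\<^sup>2 < effort_cost P / 2 * ?e\<^sup>2"
    using less effort_cost_pos by (intro mult_strict_left_mono power_strict_mono) auto
  then have "b * profit ?e' < b * profit ?e" "b' * profit ?e - b' * profit ?e' > 0
      \<Longrightarrow> (b' - b) * (profit ?e - profit ?e') \<le> 0"
    using effort_maximal[of b ?e'] effort_maximal[of b' ?e] assms av by (auto simp: algebra_simps)
  moreover have "profit ?e' < profit ?e" using calculation(1) ge by (cases "profit ?e' = profit ?e") auto
  ultimately have "(b' - b) * (profit ?e - profit ?e') \<le> 0"
    using \<open>b < b'\<close> assms(1) by simp
  then show False
    using \<open>profit ?e' < profit ?e\<close> \<open>b < b'\<close> by (simp add: mult_le_0_iff)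
qed

text \<open>The efforts converge by monotonicity, optimality passes to the limit because the profit is
  continuous, and the optimal effort at the limiting intensity is unique.  The bound by \<open>c\<close>
  below one keeps the limit among the available efforts even where an effort that drives the
  transfer price to zero is not available.\<close>

lemma effort_tendsto:
  assumes "monoseq B" "B \<longlonglongrightarrow> b" "\<And>n. 0 \<le> B n" "\<And>n. B n \<le> c" "c < 1"
  shows "(\<lambda>n. effort (B n)) \<longlonglongrightarrow> effort b"
proof -
  have b: "0 \<le> b" "b \<le> c"
    using LIMSEQ_le_const[OF assms(2)] LIMSEQ_le_const2[OF assms(2)] assms(3,4) by auto
  have B: "B n < 1" for n using assms(4)[of n] assms(5) by simp
  have c: "0 \<le> c" using b by simp
  have bounds: "effort 0 \<le> effort (B n)" "effort (B n) \<le> effort c" for n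
    using assms B effort_mono by auto
  have "monoseq (\<lambda>n. effort (B n))"
    using assms(1,3) B unfolding monoseq_def by (meson effort_mono)
  moreover have "Bseq (\<lambda>n. effort (B n))"
    using bounds by (intro BseqI'[of _ "max \<bar>effort 0\<bar> \<bar>effort c\<bar>"]) (smt (verit) real_norm_def)
  ultimately obtain L where L: "(\<lambda>n. effort (B n)) \<longlonglongrightarrow> L"
    using Bseq_monoseq_convergent convergent_def by blast
  have "effort 0 \<le> L" "L \<le> effort c"
    using LIMSEQ_le_const[OF L] LIMSEQ_le_const2[OF L] bounds by auto
  moreover have ends: "effort 0 \<in> available" "effort c \<in> available"
    using effort_available c assms(5) by auto
  ultimately have L_av: "L \<in> available" by (intro available_between[OF ends])
  have "(\<lambda>n. profit (effort (B n)) - profit L) \<longlonglongrightarrow> 0"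
  proof (rule Lim_null_comparison)
    show "\<forall>\<^sub>F n in sequentially. norm (profit (effort (B n)) - profit L)
        \<le> slope * Y (effort c) * \<bar>effort (B n) - L\<bar>"
      using profit_lipschitz[OF L_av effort_available ends(2)] assms(3) B bounds \<open>L \<le> effort c\<close>
      by (auto intro!: always_eventually)
    show "(\<lambda>n. slope * Y (effort c) * \<bar>effort (B n) - L\<bar>) \<longlonglongrightarrow> 0"
      using L by (auto intro!: tendsto_eq_intros)
  qed
  then have profit_lim: "(\<lambda>n. profit (effort (B n))) \<longlonglongrightarrow> profit L"
    by (simp add: LIM_zero_iff)
  have "b * profit x - effort_cost P / 2 * x\<^sup>2 \<le> b * profit L - effort_cost P / 2 * L\<^sup>2"
    if "x \<in> available" for x
  proof (rule LIMSEQ_le)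
    show "(\<lambda>n. B n * profit x - effort_cost P / 2 * x\<^sup>2)
        \<longlonglongrightarrow> b * profit x - effort_cost P / 2 * x\<^sup>2"
      using assms(2) by (intro tendsto_intros)
    show "(\<lambda>n. B n * profit (effort (B n)) - effort_cost P / 2 * (effort (B n))\<^sup>2)
        \<longlonglongrightarrow> b * profit L - effort_cost P / 2 * L\<^sup>2"
      using assms(2) L profit_lim by (intro tendsto_intros)
    show "\<exists>N. \<forall>n\<ge>N. B n * profit x - effort_cost P / 2 * x\<^sup>2
        \<le> B n * profit (effort (B n)) - effort_cost P / 2 * (effort (B n))\<^sup>2"
      using effort_maximal[OF assms(3) B that] by blast
  qed
  then have "agent_optimal P f Y 0 b L"
    using L_av by (simp add: agent_optimal_iff)
  then show ?thesis
    using L agent_optimal_eq_effort b assms(5) by auto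
qed

text \<open>The first-order condition \<open>b * slope * Y e = k * e\<close> recovers the intensity from
  an interior effort.\<close>

lemma intensity_unique:
  assumes "effort b = e" "effort b' = e" "e \<in> interior (operating_efforts P)"
    and "0 \<le> b" "b < 1" "0 \<le> b'" "b' < 1"
  shows "b = b'"
proof -
  have foc: "\<beta> * (slope * Y e) = effort_cost P * e" if \<beta>: "effort \<beta> = e" "0 \<le> \<beta>" "\<beta> < 1" for \<beta>
  proof -
    let ?h = "\<lambda>x. \<beta> * profit x - effort_cost P / 2 * x\<^sup>2"
    obtain \<epsilon> where \<epsilon>: "0 < \<epsilon>" "ball e \<epsilon> \<subseteq> interior (operating_efforts P)"
      using assms(3) open_contains_ball open_interior by blast
    have "(?h has_real_derivative \<beta> * (slope * Y e) - effort_cost P * e) (at e)"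
      using profit_has_derivative[OF assms(3)]
      by (auto intro!: derivative_eq_intros simp: field_simps)
    moreover have "\<forall>x. \<bar>e - x\<bar> < \<epsilon> \<longrightarrow> ?h x \<le> ?h e"
    proof (intro allI impI)
      fix x assume "\<bar>e - x\<bar> < \<epsilon>"
      then have "x \<in> interior (operating_efforts P)" using \<epsilon>(2) by (auto simp: dist_real_def)
      then have "x \<in> available"
        using interior_operating_efforts available_if_price_between by blast
      then show "?h x \<le> ?h e" using effort_maximal[OF \<beta>(2,3)] \<beta>(1) by simp
    qed
    ultimately have "\<beta> * (slope * Y e) - effort_cost P * e = 0"
      using \<epsilon>(1) by (intro DERIV_local_max)
    then show ?thesis by simp
  qed
  have "b * (slope * Y e) = b' * (slope * Y e)"
    using foc assms by simp
  moreover have "0 < slope * Y e"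
    using slope_pos response_pos[OF assms(3)] by (rule mult_pos_pos)
  ultimately show ?thesis by (metis less_irrefl mult_right_cancel)
qed

text \<open>Only efforts induced by some contract compete, so the first-order condition at an optimum
  needs such efforts on both sides of it.  They are reached along intensities converging to
  \<open>b\<close> from either side.\<close>

lemma induced_effort_first_order:
  assumes "0 < b" "b < 1" "effort b \<in> interior (operating_efforts P)"
    and deriv: "(h has_real_derivative d) (at (effort b))"
    and max: "\<And>b'. 0 \<le> b' \<Longrightarrow> b' < 1 \<Longrightarrow> h (effort b') \<le> h (effort b)"
  shows "d = 0"
proof -
  let ?e = "effort b"
  let ?q = "\<lambda>x. (h x - h ?e) / (x - ?e)"
  have quotients: "(\<lambda>n. ?q (effort (B n))) \<longlonglongrightarrow> d"
    if "monoseq B" "B \<longlonglongrightarrow> b" "\<And>n. 0 \<le> B n" "\<And>n. B n \<le> c" "c < 1" "\<And>n. B n \<noteq> b" for B c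
  proof -
    have "B n < 1" for n
      using that(4)[of n] that(5) by simp
    then have "effort (B n) \<noteq> ?e" for n
      using intensity_unique[OF _ refl assms(3), of "B n"] that(3,6) assms(1,2) by fastforce
    then have "\<forall>\<^sub>F n in sequentially. effort (B n) \<noteq> ?e"
      by (simp add: always_eventually)
    moreover have "?q \<midarrow>?e\<rightarrow> d"
      using deriv by (simp add: has_field_derivative_iff)
    moreover have "(\<lambda>n. effort (B n)) \<longlonglongrightarrow> ?e"
      using effort_tendsto[OF that(1-5)] .
    ultimately show ?thesis
      using tendsto_compose_eventually by blast
  qed
  have null: "(\<lambda>n. c / real (Suc n)) \<longlonglongrightarrow> 0" for c
    using LIMSEQ_Suc[OF lim_const_over_n[of c]] .
  have dec: "c / real (Suc n) \<le> c / real (Suc m)" if "0 < c" "m \<le> n" for c :: real and m n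
    using that by (intro divide_left_mono) auto
  have frac: "c / real (Suc n) \<le> c" "0 < c / real (Suc n)" if "0 < c" for c :: real and n
    using that by (auto simp: field_simps)
  define r where "r = (1 - b) / 2"
  have r: "0 < r" "b + r < 1" using assms by (auto simp: r_def field_simps)
  define above below where "above n = b + r / real (Suc n)" and "below n = b - b / real (Suc n)" for n
  have above: "b < above n" "above n \<le> b + r" for n
    using frac[OF r(1)] by (auto simp: above_def)
  have below: "0 \<le> below n" "below n < b" for n
    using frac[OF assms(1)] by (auto simp: below_def)
  have "(\<lambda>n. ?q (effort (above n))) \<longlonglongrightarrow> d"
  proof (rule quotients[of above "b + r"])
    show "monoseq above"
      using dec[OF r(1)] by (intro decseq_imp_monoseq) (auto simp: decseq_def above_def)
    show "above \<longlonglongrightarrow> b"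
      unfolding above_def using tendsto_add[OF tendsto_const[of b] null[of r]] by simp
    show "0 \<le> above n" "above n \<noteq> b" for n using above(1)[of n] assms(1) by auto
  qed (use above r in auto)
  moreover have "?q (effort (above n)) \<le> 0" for n
  proof -
    have "?e \<le> effort (above n)" "h (effort (above n)) \<le> h ?e"
      using above[of n] r assms(1) by (auto intro!: effort_mono max)
    then show ?thesis by (simp add: divide_le_0_iff)
  qed
  ultimately have "d \<le> 0"
    using LIMSEQ_le_const2[of "\<lambda>n. ?q (effort (above n))" d 0] by blast
  have "(\<lambda>n. ?q (effort (below n))) \<longlonglongrightarrow> d"
  proof (rule quotients[of below b])
    show "monoseq below"
      using dec[OF assms(1)] by (intro incseq_imp_monoseq) (auto simp: incseq_def below_def)
    show "below \<longlonglongrightarrow> b"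
      unfolding below_def using tendsto_diff[OF tendsto_const[of b] null[of b]] by simp
    show "below n \<noteq> b" "below n \<le> b" for n using below(2)[of n] by auto
  qed (use below assms in auto)
  moreover have "0 \<le> ?q (effort (below n))" for n
  proof -
    have "effort (below n) \<le> ?e" "h (effort (below n)) \<le> h ?e"
      using below[of n] assms by (auto intro!: effort_mono max)
    then show ?thesis by (simp add: zero_le_divide_iff)
  qed
  ultimately have "0 \<le> d"
    using LIMSEQ_le_const[of "\<lambda>n. ?q (effort (below n))" d 0] by blast
  with \<open>d \<le> 0\<close> show ?thesis by simp
qed


section \<open>The headquarters' problem\<close>

text \<open>With the participation constraint binding, the headquarters pays the reservation wage plus
  the effort cost.  This is what remains of the pre-tax income of the procurement side, as a
  function of effort alone.\<close>

definition procurement_income :: "real \<Rightarrow> real" where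
  "procurement_income e = royalty P * profit e - reservation_wage P - effort_cost P / 2 * e\<^sup>2
     + markup P * unit_cost P e * Y e"

definition reduced_payoff :: "real \<Rightarrow> real \<Rightarrow> real" where
  "reduced_payoff \<Delta> e = (1 - retail_tax P) * (1 - royalty P) * profit e
     + (1 - retail_tax P + \<Delta>) * procurement_income e"

lemma hq_payoff_eq:
  "hq_payoff P f Y (retail_tax P - \<Delta>) A b e = reduced_payoff \<Delta> e
     - (1 - retail_tax P + \<Delta>) * (agent_payoff P f Y A b e - reservation_wage P)"
  by (simp add: hq_payoff_def agent_payoff_def reduced_payoff_def procurement_income_def algebra_simps)

text \<open>The fixed payment transfers income to the agent at no effect on effort, so any rent above
  the reservation wage is lost to the headquarters; every alternative intensity can be offered
  without rent.\<close>

lemma optimal_contract_reduced: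
  assumes "optimal_contract P f Y (retail_tax P - \<Delta>) A b e" "0 \<le> \<Delta>"
  shows "0 \<le> b" "b < 1" "e = effort b"
    and "\<And>b'. 0 \<le> b' \<Longrightarrow> b' < 1 \<Longrightarrow> reduced_payoff \<Delta> (effort b') \<le> reduced_payoff \<Delta> e"
proof -
  let ?hq = "hq_payoff P f Y (retail_tax P - \<Delta>)"
  have feas: "feasible_contract P f Y A b e"
    and best: "\<And>A' b' e'. feasible_contract P f Y A' b' e' \<Longrightarrow> ?hq A' b' e' \<le> ?hq A b e"
    using assms(1) by (auto simp: optimal_contract_def is_arg_max_linorder)
  show "0 \<le> b" "b < 1" "e = effort b"
    using feas agent_optimal_eq_effort by (auto simp: feasible_contract_def)
  fix b' :: real assume b': "0 \<le> b'" "b' < 1"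
  define A' where "A' = reservation_wage P - agent_payoff P f Y 0 b' (effort b')"
  have wage: "agent_payoff P f Y A' b' (effort b') = reservation_wage P"
    by (simp add: A'_def agent_payoff_def)
  then have "feasible_contract P f Y A' b' (effort b')"
    using b' agent_optimal_eq_effort by (simp add: feasible_contract_def)
  then have "reduced_payoff \<Delta> (effort b') \<le> ?hq A b e"
    using best hq_payoff_eq wage by (metis diff_self mult_zero_right diff_zero)
  also have "\<dots> \<le> reduced_payoff \<Delta> e"
    using feas assms(2) retail_tax_less_one by (simp add: hq_payoff_eq feasible_contract_def)
  finally show "reduced_payoff \<Delta> (effort b') \<le> reduced_payoff \<Delta> e" .
qed

lemma procurement_income_differentiable:
  assumes "e \<in> interior (operating_efforts P)"
  obtains d where "(procurement_income has_real_derivative d) (at e)"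
proof -
  obtain c where "(Y has_real_derivative c) (at e)"
    using response_differentiable[OF assms] .
  moreover have "(unit_cost P has_real_derivative - effort_effect P) (at e)"
    unfolding unit_cost_def by (auto intro!: derivative_eq_intros)
  ultimately have "\<exists>d. (procurement_income has_real_derivative d) (at e)"
    unfolding procurement_income_def
    by (intro exI) (rule derivative_intros profit_has_derivative[OF assms] | assumption)+
  then show thesis using that by blast
qed

text \<open>Adding the two revealed-preference inequalities excludes a rise in effort, and the two
  first-order conditions exclude equality.\<close>

lemma optimal_contract_strict_mono:
  assumes opt\<^sub>1: "optimal_contract P f Y (retail_tax P - \<Delta>\<^sub>1) A\<^sub>1 b\<^sub>1 e\<^sub>1"
    and opt\<^sub>2: "optimal_contract P f Y (retail_tax P - \<Delta>\<^sub>2) A\<^sub>2 b\<^sub>2 e\<^sub>2"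
    and \<Delta>: "0 \<le> \<Delta>\<^sub>1" "\<Delta>\<^sub>1 < \<Delta>\<^sub>2"
    and b: "0 < b\<^sub>1" "0 < b\<^sub>2"
    and int: "e\<^sub>1 \<in> interior (operating_efforts P)" "e\<^sub>2 \<in> interior (operating_efforts P)"
  shows "b\<^sub>2 < b\<^sub>1 \<and> e\<^sub>2 < e\<^sub>1"
proof -
  let ?\<rho> = "(1 - retail_tax P) * (1 - royalty P)" and ?w = "\<lambda>\<Delta>. 1 - retail_tax P + \<Delta>"
  let ?G = procurement_income
  have "0 \<le> \<Delta>\<^sub>2" using \<Delta> by simp
  note r\<^sub>1 = optimal_contract_reduced[OF opt\<^sub>1 \<Delta>(1)]
    and r\<^sub>2 = optimal_contract_reduced[OF opt\<^sub>2 \<open>0 \<le> \<Delta>\<^sub>2\<close>]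
  have \<rho>: "0 < ?\<rho>" and w: "0 < ?w \<Delta>\<^sub>1" "?w \<Delta>\<^sub>1 < ?w \<Delta>\<^sub>2"
    using retail_tax_less_one royalty_less_one \<Delta> by simp_all
  have av: "e\<^sub>1 \<in> available" "e\<^sub>2 \<in> available"
    using int interior_operating_efforts available_if_price_between by blast+
  have "e\<^sub>2 \<le> e\<^sub>1"
  proof (rule ccontr)
    assume "\<not> e\<^sub>2 \<le> e\<^sub>1"
    then have "0 < slope * Y e\<^sub>1 * (e\<^sub>2 - e\<^sub>1)"
      using slope_pos response_pos[OF int(1)] by simp
    then have gain: "0 < profit e\<^sub>2 - profit e\<^sub>1"
      using profit_supporting_line[OF av] by simp
    have pref\<^sub>1: "?\<rho> * (profit e\<^sub>2 - profit e\<^sub>1) \<le> ?w \<Delta>\<^sub>1 * (?G e\<^sub>1 - ?G e\<^sub>2)"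
      using r\<^sub>1(4)[OF r\<^sub>2(1,2)] r\<^sub>2(3) by (simp add: reduced_payoff_def right_diff_distrib)
    have pref\<^sub>2: "?w \<Delta>\<^sub>2 * (?G e\<^sub>1 - ?G e\<^sub>2) \<le> ?\<rho> * (profit e\<^sub>2 - profit e\<^sub>1)"
      using r\<^sub>2(4)[OF r\<^sub>1(1,2)] r\<^sub>1(3) by (simp add: reduced_payoff_def right_diff_distrib)
    have "0 < ?w \<Delta>\<^sub>1 * (?G e\<^sub>1 - ?G e\<^sub>2)"
      using mult_pos_pos[OF \<rho> gain] pref\<^sub>1 by simp
    then have "0 < ?G e\<^sub>1 - ?G e\<^sub>2" using w(1) zero_less_mult_pos by blast
    then have "?w \<Delta>\<^sub>1 * (?G e\<^sub>1 - ?G e\<^sub>2) < ?w \<Delta>\<^sub>2 * (?G e\<^sub>1 - ?G e\<^sub>2)"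
      using w(2) by (rule mult_strict_right_mono[rotated])
    then show False using pref\<^sub>1 pref\<^sub>2 by simp
  qed
  moreover have "e\<^sub>1 \<noteq> e\<^sub>2"
  proof
    assume eq: "e\<^sub>1 = e\<^sub>2"
    obtain d where d: "(?G has_real_derivative d) (at e\<^sub>1)"
      using procurement_income_differentiable[OF int(1)] .
    have deriv: "(reduced_payoff \<Delta> has_real_derivative ?\<rho> * (slope * Y e\<^sub>1) + ?w \<Delta> * d) (at e\<^sub>1)" for \<Delta>
      unfolding reduced_payoff_def
      by (intro DERIV_add DERIV_cmult profit_has_derivative[OF int(1)] d)
    have "?\<rho> * (slope * Y e\<^sub>1) + ?w \<Delta>\<^sub>1 * d = 0"
      using induced_effort_first_order[OF b(1) r\<^sub>1(2)] deriv r\<^sub>1(3,4) int(1) by blast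
    moreover have "?\<rho> * (slope * Y e\<^sub>1) + ?w \<Delta>\<^sub>2 * d = 0"
      using induced_effort_first_order[OF b(2) r\<^sub>2(2)] deriv r\<^sub>2(3,4) int(2) eq by metis
    ultimately have foc: "?\<rho> * (slope * Y e\<^sub>1) + ?w \<Delta>\<^sub>1 * d = 0" "?w \<Delta>\<^sub>1 * d = ?w \<Delta>\<^sub>2 * d"
      by linarith+
    then have "d = 0" using w(2) by (metis less_irrefl mult_right_cancel)
    then have "?\<rho> * (slope * Y e\<^sub>1) = 0" using foc(1) by simp
    moreover have "0 < ?\<rho> * (slope * Y e\<^sub>1)"
      using mult_pos_pos[OF \<rho> mult_pos_pos[OF slope_pos response_pos[OF int(1)]]] .
    ultimately show False by (metis less_irrefl)
  qed
  ultimately have less: "e\<^sub>2 < e\<^sub>1" by simp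
  moreover have "b\<^sub>2 < b\<^sub>1"
    using effort_mono[of b\<^sub>1 b\<^sub>2] r\<^sub>1 r\<^sub>2 less by (cases "b\<^sub>2 < b\<^sub>1") auto
  ultimately show ?thesis by simp
qed

end

theorem proposition2:
  fixes M :: "'a measure" and D :: "'a \<Rightarrow> real" and f :: "real \<Rightarrow> real"
    and P :: firm
    and Y :: "real \<Rightarrow> real"
    and S :: "real set"
    and b_opt e_opt :: "real \<Rightarrow> real"
  assumes demand: "igfr_demand M D f"
    and params: "0 < retail_price P" "0 < material_price P" "0 < effort_effect P"
      "0 < effort_cost P" "0 < markup P" "0 < royalty P" "royalty P < 1"
      "0 \<le> reservation_wage P" "0 < retail_tax P" "retail_tax P < 1"
    and response: "retail_response P f Y"
    and differences: "S \<subseteq> {0<..retail_tax P}"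
    and agent_unique: "\<And>A b. 0 \<le> b \<Longrightarrow> b < 1 \<Longrightarrow> \<exists>!e. agent_optimal P f Y A b e"
    and hq_unique: "\<And>\<Delta>. \<Delta> \<in> S \<Longrightarrow> \<exists>!b. \<exists>A e. optimal_contract P f Y (retail_tax P - \<Delta>) A b e"
    and optimal: "\<And>\<Delta>. \<Delta> \<in> S \<Longrightarrow>
      \<exists>A. optimal_contract P f Y (retail_tax P - \<Delta>) A (b_opt \<Delta>) (e_opt \<Delta>)"
    and intensity_interior: "\<And>\<Delta>. \<Delta> \<in> S \<Longrightarrow> b_opt \<Delta> \<in> {0<..<1}"
    and effort_interior: "\<And>\<Delta>. \<Delta> \<in> S \<Longrightarrow> e_opt \<Delta> \<in> interior (operating_efforts P)"
  shows "strict_antimono_on S b_opt \<and> strict_antimono_on S e_opt"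
proof -
  interpret limited_risk_firm M D f P Y
  proof -
    interpret igfr_demand M D f by (rule demand)
    show "limited_risk_firm M D f P Y"
      by unfold_locales (use params response agent_unique in auto)
  qed
  have "b_opt \<Delta>\<^sub>2 < b_opt \<Delta>\<^sub>1 \<and> e_opt \<Delta>\<^sub>2 < e_opt \<Delta>\<^sub>1"
    if \<Delta>: "\<Delta>\<^sub>1 \<in> S" "\<Delta>\<^sub>2 \<in> S" "\<Delta>\<^sub>1 < \<Delta>\<^sub>2" for \<Delta>\<^sub>1 \<Delta>\<^sub>2
  proof -
    obtain A\<^sub>1 A\<^sub>2 where
      "optimal_contract P f Y (retail_tax P - \<Delta>\<^sub>1) A\<^sub>1 (b_opt \<Delta>\<^sub>1) (e_opt \<Delta>\<^sub>1)"
      "optimal_contract P f Y (retail_tax P - \<Delta>\<^sub>2) A\<^sub>2 (b_opt \<Delta>\<^sub>2) (e_opt \<Delta>\<^sub>2)"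
      using optimal \<Delta> by blast
    moreover have "0 \<le> \<Delta>\<^sub>1" "0 < b_opt \<Delta>\<^sub>1" "0 < b_opt \<Delta>\<^sub>2"
      using differences intensity_interior \<Delta> by force+
    ultimately show ?thesis
      using optimal_contract_strict_mono \<Delta> effort_interior by blast
  qed
  then show ?thesis
    by (auto simp: monotone_on_def)
qed

end
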